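(* Let $p\ge1$ and let $\mathbb W=\{v\in C^1(\Omega):v|_K\in\mathcal P_p(K)\ \forall K\in\mathcal T\}$. If $$\tilde{\mathbb W}=\{v\in C(\Omega):v|_K\in\mathcal P_p(K)\ \forall K\in\mathcal T\},\qquad\mathbb G=\{\boldsymbol\theta\in C(\Omega)^d:\boldsymbol\theta|_K\in[\mathcal P_{p-1}(K)]^d\ \forall K\in\mathcal T\},$$ then $$\mathbb W=\{\tilde v\in\tilde{\mathbb W}:\nabla\tilde v\in\mathbb G\}.$$
   Context: $d\in\{2,3\}$, $\Omega\subset\mathbb R^d$ is a connected Lipschitz polyhedral domain, and $\mathcal T$ is a shape regular partition of $\Omega$ into simplices such that the nonempty intersection of any two distinct elements is a single common sub-simplex of both. $\mathcal P_p(K)$ is the space of polynomials of total degree at most $p$ on $K$; $\nabla\tilde v$ is the (weak) gradient. *)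

theory Defs
  imports "HOL-Analysis.Analysis"
begin

(* In the coordinate direction e, Omega lies near x0 strictly above the graph of \<gamma>;
   x - (x \<bullet> e) *\<^sub>R e is the orthogonal projection of x to the hyperplane normal to e. *)
definition lipschitz_boundary :: "'a::euclidean_space set \<Rightarrow> bool" where
  "lipschitz_boundary \<Omega> \<longleftrightarrow>
     (\<forall>x0 \<in> frontier \<Omega>. \<exists>e \<gamma> L r. norm e = 1 \<and> r > 0 \<and>
        L-lipschitz_on {y. y \<bullet> e = 0} (\<gamma> :: 'a \<Rightarrow> real) \<and>
        \<Omega> \<inter> ball x0 r = {x \<in> ball x0 r. \<gamma> (x - (x \<bullet> e) *\<^sub>R e) < x \<bullet> e})"

(* polytope means convex polytope; polyhedral domains themselves need not be convex. *)
definition lipschitz_polyhedral_domain :: "'a::euclidean_space set \<Rightarrow> bool" where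
  "lipschitz_polyhedral_domain \<Omega> \<longleftrightarrow>
     open \<Omega> \<and> \<Omega> \<noteq> {} \<and> connected \<Omega> \<and> bounded \<Omega> \<and> lipschitz_boundary \<Omega> \<and>
     (\<exists>\<P>. finite \<P> \<and> (\<forall>P\<in>\<P>. polytope P) \<and> closure \<Omega> = \<Union>\<P>)"

(* The elements are closed simplices of full dimension. The predicate triangulation contains
   finiteness and the requirement that the intersection of two elements is a face of both:
   as the empty set is a face, this only restricts nonempty intersections, and the nonempty
   faces of a simplex are its sub-simplices. *)
definition simplicial_partition :: "'a::euclidean_space set set \<Rightarrow> 'a set \<Rightarrow> bool" where
  "simplicial_partition \<T> \<Omega> \<longleftrightarrow>
     triangulation \<T> \<and> (\<forall>K\<in>\<T>. int DIM('a) simplex K) \<and> \<Union>\<T> = closure \<Omega>"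

definition inradius :: "'a::euclidean_space set \<Rightarrow> real" where
  "inradius K = Sup {r. 0 \<le> r \<and> (\<exists>x. cball x r \<subseteq> K)}"

definition shape_regular :: "real \<Rightarrow> 'a::euclidean_space set set \<Rightarrow> bool" where
  "shape_regular \<sigma> \<T> \<longleftrightarrow> (\<forall>K\<in>\<T>. diameter K \<le> \<sigma> * inradius K)"

definition poly_on :: "nat \<Rightarrow> (real^'d) set \<Rightarrow> (real^'d \<Rightarrow> real) \<Rightarrow> bool" where
  "poly_on p S f \<longleftrightarrow>
     (\<exists>c :: ('d \<Rightarrow> nat) \<Rightarrow> real. \<forall>x\<in>S.
        f x = (\<Sum>\<alpha> | (\<Sum>i\<in>UNIV. \<alpha> i) \<le> p. c \<alpha> * (\<Prod>i\<in>UNIV. x $ i ^ \<alpha> i)))"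

(* Meant for open S: f is of class C^k on S. *)
primrec C_k :: "nat \<Rightarrow> (real^'d) set \<Rightarrow> (real^'d \<Rightarrow> real) \<Rightarrow> bool" where
  "C_k 0 S f \<longleftrightarrow> continuous_on S f"
| "C_k (Suc k) S f \<longleftrightarrow>
     (\<exists>g. (\<forall>x\<in>S. GDERIV f x :> g x) \<and> (\<forall>i. C_k k S (\<lambda>x. g x $ i)))"

(* C_c^infinity(Omega), its elements being extended by zero to the whole space *)
definition test_function :: "(real^'d) set \<Rightarrow> (real^'d \<Rightarrow> real) \<Rightarrow> bool" where
  "test_function \<Omega> \<phi> \<longleftrightarrow>
     (\<forall>k. C_k k UNIV \<phi>) \<and> compact (closure {x. \<phi> x \<noteq> 0}) \<and> closure {x. \<phi> x \<noteq> 0} \<subseteq> \<Omega>"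

definition locally_integrable :: "(real^'d) set \<Rightarrow> (real^'d \<Rightarrow> 'b::euclidean_space) \<Rightarrow> bool" where
  "locally_integrable \<Omega> f \<longleftrightarrow> (\<forall>C. compact C \<and> C \<subseteq> \<Omega> \<longrightarrow> f absolutely_integrable_on C)"

(* \<theta> is a representative of the weak gradient of v, which is unique up to null sets. *)
definition weak_gradient ::
    "(real^'d) set \<Rightarrow> (real^'d \<Rightarrow> real) \<Rightarrow> (real^'d \<Rightarrow> real^'d) \<Rightarrow> bool" where
  "weak_gradient \<Omega> v \<theta> \<longleftrightarrow>
     locally_integrable \<Omega> v \<and> locally_integrable \<Omega> \<theta> \<and>
     (\<forall>\<phi> g. test_function \<Omega> \<phi> \<and> (\<forall>x. GDERIV \<phi> x :> g x) \<longrightarrow>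
        (\<forall>i. (LINT x:\<Omega>|lebesgue. v x * g x $ i) = - (LINT x:\<Omega>|lebesgue. \<theta> x $ i * \<phi> x)))"

(* Functions on Omega are represented by total functions. Membership in the spaces below, and
   weak_gradient, depend only on the values on the open set Omega, so that equality of such
   sets is equality of the corresponding spaces of functions on Omega. In particular the
   restriction to a (closed) element K is taken on the part of K in Omega. *)

definition W_space :: "(real^'d) set \<Rightarrow> (real^'d) set set \<Rightarrow> nat \<Rightarrow> (real^'d \<Rightarrow> real) set" where
  "W_space \<Omega> \<T> p = {v. C_k 1 \<Omega> v \<and> (\<forall>K\<in>\<T>. poly_on p (K \<inter> \<Omega>) v)}"

definition W_tilde_space :: "(real^'d) set \<Rightarrow> (real^'d) set set \<Rightarrow> nat \<Rightarrow> (real^'d \<Rightarrow> real) set" where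
  "W_tilde_space \<Omega> \<T> p = {v. continuous_on \<Omega> v \<and> (\<forall>K\<in>\<T>. poly_on p (K \<inter> \<Omega>) v)}"

(* Here p \<ge> 1, so that p - 1 is not truncated. *)
definition G_space :: "(real^'d) set \<Rightarrow> (real^'d) set set \<Rightarrow> nat \<Rightarrow> (real^'d \<Rightarrow> real^'d) set" where
  "G_space \<Omega> \<T> p =
     {\<theta>. continuous_on \<Omega> \<theta> \<and> (\<forall>K\<in>\<T>. \<forall>i. poly_on (p - 1) (K \<inter> \<Omega>) (\<lambda>x. \<theta> x $ i))}"

end

(* The content is analytic: a continuous function whose weak gradient has a continuous
   representative theta is differentiable with gradient theta. Mollifying v and theta with a
   smooth bump gives smooth functions with grad(v_eps) = theta_eps, and both converge locally
   uniformly. Conversely, for v of class C^1 and a test function phi, the integral of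
   x |-> (v phi)(x + s e_i) does not depend on s, and differentiating it under the integral sign
   is integration by parts. The mesh only enters through the degree of the gradient: on the
   interior of an element it is obtained by differentiating a polynomial, and every element is
   in the closure of its interior. *)
theory Submission
  imports Defs
begin

section \<open>Smooth functions of compact support\<close>

text \<open>For \<open>n = 0\<close> this is the classical smooth function that is flat at 0. The
  powers of 1/t are carried along because differentiation produces them.\<close>

definition flat :: "nat \<Rightarrow> real \<Rightarrow> real" where
  "flat n t = (if t > 0 then inverse t ^ n * exp (- inverse t) else 0)"

lemma flat_nonneg: "flat n t \<ge> 0"
  by (simp add: flat_def)

lemma flat_0_eq_0_iff: "flat 0 t = 0 \<longleftrightarrow> t \<le> 0"
  by (auto simp: flat_def)

text \<open>From the right, u = 1/t tends to infinity and the exponential in u beats every power of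
  u; from the left the function is constantly 0.\<close>

lemma tendsto_flat_0: "(flat n \<longlongrightarrow> 0) (at 0)"
proof (rule filterlim_split_at)
  show "(flat n \<longlongrightarrow> 0) (at_left 0)"
    by (rule tendsto_eventually) (auto simp: eventually_at_filter flat_def)
  have "((\<lambda>t::real. inverse t ^ n / exp (inverse t)) \<longlongrightarrow> 0) (at_right 0)"
    by (rule filterlim_compose[OF tendsto_power_div_exp_0 filterlim_inverse_at_top_right])
  then show "(flat n \<longlongrightarrow> 0) (at_right 0)"
    by (rule Lim_transform_eventually)
      (auto simp: eventually_at_filter flat_def exp_minus divide_inverse)
qed

lemma DERIV_flat: "(flat n has_field_derivative flat (n + 2) t - real n * flat (n + 1) t) (at t)"
proof -
  consider "t < 0" | "t = 0" | "t > 0" by linarith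
  then show ?thesis
  proof cases
    case 1
    have "((\<lambda>t::real. 0::real) has_field_derivative 0) (at t)"
      by simp
    then have "(flat n has_field_derivative 0) (at t)"
      by (rule has_field_derivative_transform_within_open[where S = "{..<0}"])
        (use 1 in \<open>auto simp: flat_def\<close>)
    then show ?thesis
      using 1 by (simp add: flat_def)
  next
    case 2
    \<comment> \<open>The difference quotient at 0 is again a member of the family, so its limit is
      an instance of \<open>tendsto_flat_0\<close>.\<close>
    have "flat n h / h = flat (n + 1) h" for h
      by (simp add: flat_def divide_inverse)
    then have "((\<lambda>h. (flat n (0 + h) - flat n 0) / h) \<longlongrightarrow> 0) (at 0)"
      using tendsto_flat_0[of "n + 1"] by (simp add: flat_def[of _ 0])
    then show ?thesis
      using 2 by (simp add: DERIV_def flat_def[of _ 0])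
  next
    case 3
    have "((\<lambda>t::real. inverse t ^ n * exp (- inverse t)) has_field_derivative
        real n * (inverse t ^ (n - 1) * - (inverse t)\<^sup>2) * exp (- inverse t) +
        inverse t ^ n * (exp (- inverse t) * (inverse t)\<^sup>2)) (at t)"
      using 3 by (auto intro!: derivative_eq_intros simp: power2_eq_square)
    also have "real n * (inverse t ^ (n - 1) * - (inverse t)\<^sup>2) * exp (- inverse t) +
        inverse t ^ n * (exp (- inverse t) * (inverse t)\<^sup>2) =
        flat (n + 2) t - real n * flat (n + 1) t"
      using 3 by (cases n) (simp_all add: flat_def power2_eq_square)
    finally have "((\<lambda>t::real. inverse t ^ n * exp (- inverse t)) has_field_derivative
        flat (n + 2) t - real n * flat (n + 1) t) (at t)" .
    then show ?thesis
      by (rule has_field_derivative_transform_within_open[where S = "{0<..}"])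
        (use 3 in \<open>auto simp: flat_def\<close>)
  qed
qed

text \<open>Being closed under partial derivatives, this algebra consists of functions of class
  \<open>C_k k\<close> for every \<open>k\<close>.\<close>

inductive smooth_alg :: "(real^'d \<Rightarrow> real) \<Rightarrow> bool" where
  const: "smooth_alg (\<lambda>x. c)"
| flat: "smooth_alg (\<lambda>x. flat n (s * x $ i + b))"
| add: "smooth_alg f \<Longrightarrow> smooth_alg g \<Longrightarrow> smooth_alg (\<lambda>x. f x + g x)"
| mult: "smooth_alg f \<Longrightarrow> smooth_alg g \<Longrightarrow> smooth_alg (\<lambda>x. f x * g x)"

lemma smooth_alg_GDERIV:
  fixes f :: "real^'d \<Rightarrow> real"
  shows "smooth_alg f \<Longrightarrow> \<exists>g. (\<forall>x. GDERIV f x :> g x) \<and> (\<forall>i. smooth_alg (\<lambda>x. g x $ i))"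
proof (induction rule: smooth_alg.induct)
  case (const c)
  show ?case
    by (intro exI[of _ "\<lambda>x. 0"]) (auto intro: GDERIV_const smooth_alg.const)
next
  case (flat n s i b)
  \<comment> \<open>The minus sign is a constant factor \<open>- real n\<close>, so that
    \<open>?D\<close> is built from the constructors of \<open>smooth_alg\<close> alone.\<close>
  let ?D = "\<lambda>x. flat (n + 2) (s * x $ i + b) + (- real n) * flat (n + 1) (s * x $ i + b)"
  have 1: "GDERIV (\<lambda>x. s * x $ i + b) x :> s *\<^sub>R axis i 1" for x :: "real^'d"
    unfolding gderiv_def
    by (auto intro!: derivative_eq_intros bounded_linear.has_derivative[OF bounded_linear_vec_nth]
        simp: inner_axis)
  have 2: "GDERIV (\<lambda>x. flat n (s * x $ i + b)) x :> ?D x *\<^sub>R (s *\<^sub>R axis i 1)" for x :: "real^'d"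
    by (rule GDERIV_DERIV_compose[OF 1])
      (use DERIV_flat[of n "s * x $ i + b"] in simp)
  have 3: "smooth_alg (\<lambda>x. (?D x *\<^sub>R (s *\<^sub>R axis i 1 :: real^'d)) $ j)" for j
  proof -
    have "smooth_alg (\<lambda>x. ?D x * ((s *\<^sub>R axis i 1 :: real^'d) $ j))"
      by (intro smooth_alg.intros)
    then show ?thesis by (simp add: mult.assoc)
  qed
  show ?case
    using 2 3 by (intro exI[of _ "\<lambda>x. ?D x *\<^sub>R (s *\<^sub>R axis i 1)"]) blast
next
  case (add f g)
  then obtain F G where "\<And>x. GDERIV f x :> F x" "\<And>i. smooth_alg (\<lambda>x. F x $ i)"
    "\<And>x. GDERIV g x :> G x" "\<And>i. smooth_alg (\<lambda>x. G x $ i)" by blast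
  then show ?case
    by (intro exI[of _ "\<lambda>x. F x + G x"]) (auto intro: GDERIV_add smooth_alg.add)
next
  case (mult f g)
  then obtain F G where "\<And>x. GDERIV f x :> F x" "\<And>i. smooth_alg (\<lambda>x. F x $ i)"
    "\<And>x. GDERIV g x :> G x" "\<And>i. smooth_alg (\<lambda>x. G x $ i)" by blast
  moreover from this mult.hyps
  have "smooth_alg (\<lambda>x. (f x *\<^sub>R G x + g x *\<^sub>R F x) $ i)" for i
    using smooth_alg.add[OF smooth_alg.mult smooth_alg.mult, of f "\<lambda>x. G x $ i" g "\<lambda>x. F x $ i"]
    by simp
  ultimately show ?case
    by (intro exI[of _ "\<lambda>x. f x *\<^sub>R G x + g x *\<^sub>R F x"]) (auto intro: GDERIV_mult)
qed

lemma GDERIV_imp_continuous: "GDERIV f x :> D \<Longrightarrow> isCont f x"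
  unfolding gderiv_def by (rule has_derivative_continuous)

lemma GDERIV_imp_continuous_on: "(\<And>x. x \<in> S \<Longrightarrow> GDERIV f x :> g x) \<Longrightarrow> continuous_on S f"
  by (rule continuous_at_imp_continuous_on) (auto intro: GDERIV_imp_continuous)

lemma smooth_alg_continuous: "smooth_alg f \<Longrightarrow> continuous_on S f"
  by (meson GDERIV_imp_continuous_on smooth_alg_GDERIV)

lemma smooth_alg_C_k: "smooth_alg f \<Longrightarrow> C_k k UNIV f"
proof (induction k arbitrary: f)
  case 0
  then show ?case by (simp add: smooth_alg_continuous)
next
  case (Suc k)
  obtain g where "\<forall>x. GDERIV f x :> g x" "\<forall>i. smooth_alg (\<lambda>x. g x $ i)"
    using smooth_alg_GDERIV[OF Suc.prems] by blast
  then show ?case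
    using Suc.IH by auto
qed

text \<open>Turns the reflected bumps \<open>bump e (x - y)\<close> into smooth functions of
  \<open>y\<close>. The generators have an affine argument \<open>s * x $ i + b\<close> so that the
  algebra is stable under this operation.\<close>

lemma smooth_alg_reflect:
  fixes f :: "real^'d \<Rightarrow> real"
  shows "smooth_alg f \<Longrightarrow> smooth_alg (\<lambda>y. f (x - y))"
proof (induction rule: smooth_alg.induct)
  case (flat n s i b)
  have "(\<lambda>y. flat n (s * (x - y) $ i + b)) = (\<lambda>y. flat n ((- s) * y $ i + (s * x $ i + b)))"
    by (simp add: algebra_simps)
  then show ?case
    using smooth_alg.flat by metis
qed (auto intro: smooth_alg.intros)

section \<open>Bump functions on cubes\<close>

text \<open>A product over the coordinates stays inside \<open>smooth_alg\<close>; its support is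
  therefore a cube instead of a ball. The bump is not normalised: \<open>mollify\<close> divides by
  the mass.\<close>

definition bump :: "real \<Rightarrow> real^'d \<Rightarrow> real" where
  "bump e x = (\<Prod>i\<in>UNIV. flat 0 (e + x $ i) * flat 0 (e - x $ i))"

lemma smooth_alg_bump: "smooth_alg (bump e :: real^'d \<Rightarrow> real)"
proof -
  have *: "smooth_alg (\<lambda>x::real^'d. flat 0 (e + x $ i) * flat 0 (e - x $ i))" for i
    using smooth_alg.mult[OF smooth_alg.flat[of 0 1 i e] smooth_alg.flat[of 0 "-1" i e]]
    by (simp add: add.commute)
  have "smooth_alg (\<lambda>x::real^'d. \<Prod>i\<in>I. flat 0 (e + x $ i) * flat 0 (e - x $ i))" if "finite I" for I
    using that by induction (auto intro: smooth_alg.const smooth_alg.mult *)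
  then show ?thesis
    by (simp add: bump_def[abs_def])
qed

lemma bump_nonneg: "bump e x \<ge> 0"
  by (simp add: bump_def prod_nonneg flat_nonneg)

lemma bump_pos: "e > 0 \<Longrightarrow> bump e 0 > 0"
  by (simp add: bump_def flat_def prod_pos)

lemma bump_minus: "bump e (- x) = bump e x"
  by (simp add: bump_def mult.commute)

lemma bump_nonzero: "bump e x \<noteq> 0 \<Longrightarrow> \<bar>x $ i\<bar> < e"
  by (force simp: bump_def flat_0_eq_0_iff abs_less_iff dest: spec[of _ i])

lemma bump_eq_0: "x \<notin> cbox (vec (-e)) (vec e) \<Longrightarrow> bump e x = 0"
  using bump_nonzero[of e x] by (auto simp: mem_box_cart abs_less_iff) (smt (verit))+

section \<open>Classical gradients are weak gradients\<close>

lemma GDERIV_unique: "GDERIV f x :> D \<Longrightarrow> GDERIV f x :> D' \<Longrightarrow> D = D'"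
  unfolding gderiv_def by (drule (1) has_derivative_unique) (simp add: fun_eq_iff vector_eq_ldot)

section \<open>Integrals of compactly supported functions\<close>

text \<open>\<Omega> and the complement of \<open>S\<close> are open, cover the space, and the
  extension by zero is continuous on each. This leads from the Lebesgue integrals over \<Omega> in
  \<open>weak_gradient\<close> to integrals over a box, where translation and the Leibniz rule are
  available.\<close>

lemma compact_support_integral:
  fixes f :: "real^'d \<Rightarrow> real"
  assumes "open \<Omega>" "continuous_on \<Omega> f" "compact S" "S \<subseteq> \<Omega>"
    and z: "\<And>x. x \<in> \<Omega> - S \<Longrightarrow> f x = 0" and S: "S \<subseteq> cbox a b"
  shows "continuous_on UNIV (\<lambda>x. if x \<in> \<Omega> then f x else 0)"
    and "set_integrable lebesgue \<Omega> f"
    and "(LINT x:\<Omega>|lebesgue. f x) = integral (cbox a b) (\<lambda>x. if x \<in> \<Omega> then f x else 0)"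
proof -
  let ?f = "\<lambda>x. if x \<in> \<Omega> then f x else 0"
  have "continuous_on \<Omega> ?f"
    using \<open>continuous_on \<Omega> f\<close> by (simp cong: continuous_on_cong)
  moreover have "continuous_on (- S) ?f"
    by (rule continuous_on_eq[where f = "\<lambda>x. 0"]) (use z in auto)
  ultimately have "continuous_on (\<Omega> \<union> - S) ?f"
    using assms by (intro continuous_on_open_Un) (auto simp: compact_imp_closed)
  moreover have "\<Omega> \<union> - S = UNIV"
    using assms by auto
  ultimately show cont: "continuous_on UNIV ?f"
    by simp
  have eq: "(\<lambda>x. indicat_real \<Omega> x *\<^sub>R f x) = (\<lambda>x. indicat_real (cbox a b) x *\<^sub>R ?f x)"
    using z S by (auto simp: indicator_def fun_eq_iff)
  have "set_integrable lebesgue (cbox a b) ?f"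
    by (rule absolutely_integrable_continuous) (use cont continuous_on_subset in blast)
  then show "set_integrable lebesgue \<Omega> f"
    and "(LINT x:\<Omega>|lebesgue. f x) = integral (cbox a b) ?f"
    using set_lebesgue_integral_eq_integral(2)[of "cbox a b" ?f]
    unfolding set_integrable_def set_lebesgue_integral_def eq by auto
qed

lemma locally_integrable_continuous:
  fixes f :: "real^'d \<Rightarrow> 'b::euclidean_space"
  assumes "continuous_on \<Omega> f"
  shows "locally_integrable \<Omega> f"
  unfolding locally_integrable_def set_integrable_def
proof (intro allI impI)
  fix C assume C: "compact C \<and> C \<subseteq> \<Omega>"
  then have "integrable lborel (\<lambda>x. indicat_real C x *\<^sub>R f x)"
    by (intro borel_integrable_compact) (use assms continuous_on_subset in blast)+
  then show "integrable lebesgue (\<lambda>x. indicat_real C x *\<^sub>R f x)"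
    using integrable_completion borel_measurable_integrable by blast
qed

text \<open>Translating \<open>w\<close> along the i-th axis does not change its integral, and the
  derivative of that integral in the translation parameter is the integral of the i-th partial
  derivative.\<close>

lemma integral_gradient_compact_support:
  fixes w :: "real^'d \<Rightarrow> real"
  assumes w: "\<And>x. GDERIV w x :> G x" and G: "continuous_on UNIV (\<lambda>x. G x $ i)"
    and w0: "\<And>x. x \<notin> cbox a b \<Longrightarrow> w x = 0" and G0: "\<And>x. x \<notin> cbox a b \<Longrightarrow> G x $ i = 0"
  shows "integral (cbox a b) (\<lambda>x. G x $ i) = 0"
proof -
  let ?e = "axis i 1 :: real^'d" and ?U = "ball 0 1 :: real set"
  \<comment> \<open>A margin of 1 on every side keeps the support inside the shifted box for all |s|
    < 1, the range \<open>?U\<close> of the parameter.\<close>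
  define a' b' where "a' = a - 1" and "b' = b + 1"
  have sup: "cbox a b \<subseteq> cbox a' b'"
    unfolding a'_def b'_def mem_box_cart subset_iff
    by (simp add: algebra_simps add_increasing2 add_increasing)
  have contw: "continuous_on UNIV w"
    using w by (rule GDERIV_imp_continuous_on)
  have J: "integral (cbox a' b') (\<lambda>x. w (s *\<^sub>R ?e + x)) = integral (cbox a b) w" if "s \<in> ?U" for s
  proof -
    have "cbox a b \<subseteq> cbox (a' + s *\<^sub>R ?e) (b' + s *\<^sub>R ?e)"
    proof
      fix x assume x: "x \<in> cbox a b"
      have "\<bar>(s *\<^sub>R ?e) $ j\<bar> < 1" for j
        using that by (cases "j = i") (simp_all add: axis_def)
      then have 1: "- 1 < s * ?e $ j \<and> s * ?e $ j < 1" for j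
        by (auto simp: abs_less_iff)
      have 2: "a $ j \<le> x $ j \<and> x $ j \<le> b $ j" for j
        using x by (simp add: mem_box_cart)
      have "a $ j + (s * ?e $ j - 1) \<le> x $ j \<and> x $ j \<le> b $ j + (s * ?e $ j + 1)" for j
        using 1[of j] 2[of j] by linarith
      then show "x \<in> cbox (a' + s *\<^sub>R ?e) (b' + s *\<^sub>R ?e)"
        unfolding mem_box_cart a'_def b'_def by (simp add: algebra_simps)
    qed
    moreover have "(w has_integral integral (cbox a b) w) (cbox a b)"
      by (intro integrable_integral integrable_continuous continuous_on_subset[OF contw]) simp
    ultimately have "(w has_integral integral (cbox a b) w) (cbox (a' + s *\<^sub>R ?e) (b' + s *\<^sub>R ?e))"
      using w0 has_integral_on_superset by blast
    then show ?thesis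
      using integral_shift_cbox_plus[of a' b' w "s *\<^sub>R ?e"] by (simp add: o_def integral_unique)
  qed
  have contG: "continuous_on S (\<lambda>z. G (h z) $ i)" if "continuous_on S h"
    for S and h :: "real \<times> (real^'d) \<Rightarrow> real^'d"
    using continuous_on_compose2[OF G that] by simp
  \<comment> \<open>The Leibniz rule at s = 0 yields the integral of \<open>G x $ i\<close>, while
    by \<open>J\<close> the differentiated function is constant on \<open>?U\<close>.\<close>
  have "((\<lambda>s. integral (cbox a' b') (\<lambda>x. w (s *\<^sub>R ?e + x))) has_vector_derivative
      integral (cbox a' b') (\<lambda>x. G (0 *\<^sub>R ?e + x) $ i)) (at 0 within ?U)"
  proof (rule leibniz_rule_vector_derivative)
    fix s :: real and x
    have "((\<lambda>s. w (s *\<^sub>R ?e + x)) has_derivative (\<lambda>h. (h *\<^sub>R ?e) \<bullet> G (s *\<^sub>R ?e + x))) (at s within ?U)"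
      by (rule has_derivative_compose[OF _ w[unfolded gderiv_def]])
        (auto intro!: derivative_eq_intros)
    then show "((\<lambda>s. w (s *\<^sub>R ?e + x)) has_vector_derivative G (s *\<^sub>R ?e + x) $ i) (at s within ?U)"
      by (simp add: has_vector_derivative_def inner_axis' )
  next
    show "continuous_on (?U \<times> cbox a' b') (\<lambda>(s, x). G (s *\<^sub>R ?e + x) $ i)"
      unfolding case_prod_beta by (intro contG continuous_intros)
    show "(\<lambda>x. w (s *\<^sub>R ?e + x)) integrable_on cbox a' b'" for s
      by (intro integrable_continuous continuous_on_compose2[OF contw] continuous_intros) auto
  qed auto
  moreover have "((\<lambda>s. integral (cbox a' b') (\<lambda>x. w (s *\<^sub>R ?e + x))) has_vector_derivative 0)
      (at 0 within ?U)"
    by (rule has_vector_derivative_transform[where f = "\<lambda>s. integral (cbox a b) w"])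
      (auto simp: J)
  ultimately have "integral (cbox a' b') (\<lambda>x. G (0 *\<^sub>R ?e + x) $ i) = 0"
    unfolding at_within_open[OF centre_in_ball[THEN iffD2, OF zero_less_one] open_ball]
    by (rule vector_derivative_unique_at)
  then have "integral (cbox a' b') (\<lambda>x. G x $ i) = 0"
    by simp
  moreover have "((\<lambda>x. G x $ i) has_integral integral (cbox a b) (\<lambda>x. G x $ i)) (cbox a' b')"
    by (rule has_integral_on_superset[OF _ G0 sup])
      (intro integrable_integral integrable_continuous continuous_on_subset[OF G] subset_UNIV)
  ultimately show ?thesis
    by (simp add: integral_unique)
qed

text \<open>One compact set serves for \<phi> and its gradient alike: its complement is open and
  \<phi> vanishes identically there.\<close>

lemma test_function_support:
  assumes "test_function \<Omega> \<phi>" and g: "\<And>x. GDERIV \<phi> x :> g x"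
  obtains S where "compact S" "S \<subseteq> \<Omega>" "\<And>x. x \<notin> S \<Longrightarrow> \<phi> x = 0" "\<And>x. x \<notin> S \<Longrightarrow> g x = 0"
    "continuous_on UNIV \<phi>" "continuous_on UNIV g"
proof -
  define S where "S = closure {x. \<phi> x \<noteq> 0}"
  have 1: "compact S" "S \<subseteq> \<Omega>" using assms by (auto simp: test_function_def S_def)
  have 0: "\<phi> x = 0" if "x \<notin> S" for x
    using that subsetD[OF closure_subset, of x "{x. \<phi> x \<noteq> 0}"] by (auto simp: S_def)
  have 2: "continuous_on UNIV \<phi>"
    using g by (rule GDERIV_imp_continuous_on)
  have 3: "g x = 0" if "x \<notin> S" for x
  proof -
    have "(\<phi> has_derivative (\<lambda>h. 0)) (at x)"
      by (rule has_derivative_transform_within_open[OF has_derivative_const, where s = "- S"])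
        (use that 0 1 in \<open>simp_all add: open_Compl compact_imp_closed\<close>)
    then have "GDERIV \<phi> x :> 0"
      by (simp add: gderiv_def)
    then show ?thesis
      by (rule GDERIV_unique[OF g])
  qed
  \<comment> \<open>This only provides some gradient with continuous components; uniqueness
    identifies it with the given \<open>g\<close>.\<close>
  have "C_k (Suc 0) UNIV \<phi>"
    using assms(1) by (simp add: test_function_def del: C_k.simps)
  then obtain g' where g': "\<And>x. GDERIV \<phi> x :> g' x" "\<And>i. continuous_on UNIV (\<lambda>x. g' x $ i)"
    by auto
  have "g' = g"
    using GDERIV_unique[OF g'(1) g] by (rule ext)
  then have "continuous_on UNIV g"
    using g' continuous_on_vec_lambda[of UNIV "\<lambda>i x. g x $ i"] by simp
  with 1 0 3 2 show ?thesis
    by (rule that)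
qed

text \<open>Integration by parts: the gradient of the product of \<open>v\<close> and a test
  function has integral zero, and the product rule splits that integral into the two required
  ones.\<close>

lemma gradient_imp_weak_gradient:
  fixes \<Omega> :: "(real^'d) set"
  assumes op: "open \<Omega>" and v: "\<And>x. x \<in> \<Omega> \<Longrightarrow> GDERIV v x :> \<theta> x" and \<theta>: "continuous_on \<Omega> \<theta>"
  shows "weak_gradient \<Omega> v \<theta>"
  unfolding weak_gradient_def
proof (intro conjI allI impI)
  have contv: "continuous_on \<Omega> v"
    using v by (rule GDERIV_imp_continuous_on)
  show "locally_integrable \<Omega> v" "locally_integrable \<Omega> \<theta>"
    using locally_integrable_continuous contv \<theta> by blast+
  fix \<phi> g i assume "test_function \<Omega> \<phi> \<and> (\<forall>x. GDERIV \<phi> x :> g x)"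
  then have tf: "test_function \<Omega> \<phi>" and g: "\<And>x. GDERIV \<phi> x :> g x" by auto
  obtain S where S: "compact S" "S \<subseteq> \<Omega>" and 0: "\<And>x. x \<notin> S \<Longrightarrow> \<phi> x = 0" "\<And>x. x \<notin> S \<Longrightarrow> g x = 0"
    and cont: "continuous_on UNIV \<phi>" "continuous_on UNIV g"
    using test_function_support[OF tf g] by blast
  obtain a b where ab: "S \<subseteq> cbox a b"
    using bounded_subset_cbox_symmetric[OF compact_imp_bounded[OF S(1)]] by blast
  note [continuous_intros] = contv \<theta> continuous_on_subset[OF cont(1), of \<Omega>, simplified]
    continuous_on_subset[OF cont(2), of \<Omega>, simplified]
  \<comment> \<open>By the product rule, \<open>G\<close> is the gradient of \<open>w\<close>, the
    product of \<open>v\<close> and \<phi> extended by zero.\<close>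
  define G where "G x = (if x \<in> \<Omega> then v x *\<^sub>R g x + \<phi> x *\<^sub>R \<theta> x else 0)" for x
  define w where "w x = (if x \<in> \<Omega> then v x * \<phi> x else 0)" for x
  have Gi: "G x $ i = (if x \<in> \<Omega> then v x * g x $ i + \<theta> x $ i * \<phi> x else 0)" for x
    by (simp add: G_def mult.commute)
  have w: "GDERIV w x :> G x" for x
  proof (cases "x \<in> \<Omega>")
    case True
    have "GDERIV (\<lambda>x. v x * \<phi> x) x :> G x"
      using True GDERIV_mult[OF v g] by (simp add: G_def)
    then show ?thesis
      unfolding gderiv_def
      by (rule has_derivative_transform_within_open[OF _ op True]) (simp add: w_def)
  next
    \<comment> \<open>Outside \<Omega> the point lies in the open complement of \<open>S\<close>, on
      which \<open>w\<close> vanishes identically.\<close>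
    case False
    have "((\<lambda>x. 0) has_derivative (\<lambda>h. h \<bullet> G x)) (at x)"
      using False by (simp add: G_def)
    then show ?thesis
      unfolding gderiv_def
      by (rule has_derivative_transform_within_open[where s = "- S"])
        (use False S 0 in \<open>auto simp: w_def open_Compl compact_imp_closed\<close>)
  qed
  note ci = compact_support_integral[OF op _ S _ ab]
  have 1: "continuous_on \<Omega> (\<lambda>x. v x * g x $ i)" "continuous_on \<Omega> (\<lambda>x. \<theta> x $ i * \<phi> x)"
    "continuous_on \<Omega> (\<lambda>x. v x * g x $ i + \<theta> x $ i * \<phi> x)"
    by (intro continuous_intros)+
  have 2: "v x * g x $ i = 0" "\<theta> x $ i * \<phi> x = 0" "v x * g x $ i + \<theta> x $ i * \<phi> x = 0"
    if "x \<in> \<Omega> - S" for x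
    using that 0[of x] by auto
  have "integral (cbox a b) (\<lambda>x. G x $ i) = 0"
  proof (rule integral_gradient_compact_support[OF w])
    show "continuous_on UNIV (\<lambda>x. G x $ i)"
      unfolding Gi by (rule ci(1)[OF 1(3) 2(3)])
    fix x assume "x \<notin> cbox a b"
    then have "x \<notin> S" using ab by blast
    then show "w x = 0" "G x $ i = 0"
      using 0[of x] by (auto simp: w_def G_def)
  qed
  then have "(LINT x:\<Omega>|lebesgue. v x * g x $ i + \<theta> x $ i * \<phi> x) = 0"
    unfolding Gi using ci(3)[OF 1(3) 2(3)] by simp
  moreover have "(LINT x:\<Omega>|lebesgue. v x * g x $ i + \<theta> x $ i * \<phi> x) =
      (LINT x:\<Omega>|lebesgue. v x * g x $ i) + (LINT x:\<Omega>|lebesgue. \<theta> x $ i * \<phi> x)"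
    by (intro set_integral_add(2) ci(2)[OF 1(1) 2(1)] ci(2)[OF 1(2) 2(2)])
  ultimately show "(LINT x:\<Omega>|lebesgue. v x * g x $ i) = - (LINT x:\<Omega>|lebesgue. \<theta> x $ i * \<phi> x)"
    by simp
qed

section \<open>Continuous weak gradients are classical gradients\<close>

text \<open>The bump of parameter \<open>e\<close> lives on a cube of half-width \<open>e\<close>; by the bound of the
  Euclidean norm by the \<open>l\<^sup>1\<close> norm, this cube is in the ball of radius \<open>CARD('d) * e\<close>.\<close>

definition bump_mass :: "('d::finite) itself \<Rightarrow> real \<Rightarrow> real" where
  "bump_mass _ e = integral (cbox (vec (- e)) (vec e)) (bump e :: real^'d \<Rightarrow> real)"

text \<open>Convolution with the normalised bump, over a box only, since the functions in question
  are controlled just on \<Omega>. It is the full convolution at points whose cube of half-width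
  \<open>e\<close> fits in the box.\<close>

definition mollify ::
    "real \<Rightarrow> real^'d \<Rightarrow> real^'d \<Rightarrow> (real^'d \<Rightarrow> 'b::euclidean_space) \<Rightarrow> real^'d \<Rightarrow> 'b" where
  "mollify e a b w x =
     integral (cbox a b) (\<lambda>y. bump e (x - y) *\<^sub>R w y) /\<^sub>R bump_mass TYPE('d) e"

lemma continuous_on_bump: "continuous_on S (bump e)"
  by (rule smooth_alg_continuous[OF smooth_alg_bump])

lemma continuous_on_bump_diff: "continuous_on S (\<lambda>y. bump e (x - y))"
  by (rule continuous_on_compose2[OF continuous_on_bump[of UNIV]]) (auto intro: continuous_intros)

text \<open>A nonnegative continuous function with integral zero over a box would vanish there, but
  the bump is positive at 0.\<close>

lemma bump_mass_pos:
  assumes "e > 0"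
  shows "bump_mass TYPE('d::finite) e > 0"
proof -
  let ?C = "cbox (vec (- e)) (vec e) :: (real^'d) set"
  have int: "(bump e has_integral bump_mass TYPE('d) e) ?C"
    unfolding bump_mass_def
    by (intro integrable_integral integrable_continuous continuous_on_bump)
  have "bump_mass TYPE('d) e \<noteq> 0"
  proof
    assume "bump_mass TYPE('d) e = 0"
    with int have int0: "(bump e has_integral 0) ?C"
      by simp
    have "bump e (0 :: real^'d) = 0"
    proof (rule has_integral_0_cbox_imp_0[OF continuous_on_bump bump_nonneg int0])
      show "box (vec (- e)) (vec e) \<noteq> ({} :: (real^'d) set)" "0 \<in> ?C"
        using assms by (simp_all add: interval_ne_empty_cart mem_box_cart)
    qed
    moreover have "bump e (0 :: real^'d) > 0"
      by (rule bump_pos[OF assms])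
    ultimately show False
      by simp
  qed
  moreover have "bump_mass TYPE('d) e \<ge> 0"
    using has_integral_nonneg[OF int] bump_nonneg by blast
  ultimately show ?thesis by simp
qed

lemma bump_diff_nonzero_imp_dist:
  fixes x y :: "real^'d"
  assumes "bump e (x - y) \<noteq> 0"
  shows "dist x y \<le> real CARD('d) * e"
proof -
  have "norm (x - y) \<le> (\<Sum>i\<in>UNIV. \<bar>(x - y) $ i\<bar>)"
    by (rule norm_le_l1_cart)
  also have "\<dots> \<le> (\<Sum>i\<in>(UNIV::'d set). e)"
    by (intro sum_mono less_imp_le bump_nonzero[OF assms])
  finally show ?thesis
    by (simp add: dist_norm)
qed

text \<open>By symmetry of the bump, the integrand is its translate to the cube about
  \<open>x\<close>. The l1 bound puts that cube in the ball, hence in the box, and nothing is left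
  outside it.\<close>

lemma has_integral_bump_diff:
  fixes x :: "real^'d"
  assumes "cball x (real CARD('d) * e) \<subseteq> cbox a b"
  shows "((\<lambda>y. bump e (x - y)) has_integral bump_mass TYPE('d) e) (cbox a b)"
proof -
  let ?C = "cbox (vec (- e) + x) (vec e + x)"
  have "?C \<subseteq> cball x (real CARD('d) * e)"
  proof
    fix y assume y: "y \<in> ?C"
    have "norm (x - y) \<le> (\<Sum>i\<in>UNIV. \<bar>(x - y) $ i\<bar>)"
      by (rule norm_le_l1_cart)
    also have "\<dots> \<le> (\<Sum>i\<in>(UNIV::'d set). e)"
    proof (rule sum_mono)
      fix i
      have "- e + x $ i \<le> y $ i" "y $ i \<le> e + x $ i"
        using y by (auto simp: mem_box_cart)
      then show "\<bar>(x - y) $ i\<bar> \<le> e"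
        by simp
    qed
    finally show "y \<in> cball x (real CARD('d) * e)"
      by (simp add: dist_norm)
  qed
  with assms have sub: "?C \<subseteq> cbox a b" by simp
  have eq: "bump e (x - y) = bump e (y - x)" for y
    using bump_minus[of e "x - y"] by simp
  have "((\<lambda>y. bump e (y - x)) \<circ> (+) x has_integral bump_mass TYPE('d) e) (cbox (vec (- e)) (vec e))"
    unfolding o_def bump_mass_def
    by (simp add: integrable_integral integrable_continuous continuous_on_bump)
  then have "((\<lambda>y. bump e (x - y)) has_integral bump_mass TYPE('d) e) ?C"
    unfolding eq by (simp only: has_integral_shift_cbox_iff)
  moreover have "bump e (x - y) = 0" if "y \<notin> ?C" for y
  proof -
    have "y - x \<notin> cbox (vec (- e)) (vec e)"
      using that by (simp add: mem_box_cart algebra_simps)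
    then show ?thesis
      unfolding eq by (rule bump_eq_0)
  qed
  ultimately show ?thesis
    using has_integral_on_superset sub by blast
qed

section \<open>Convergence of mollifications\<close>

text \<open>The normalised bump has total weight 1 on the box, so the error is the weighted mean of
  \<open>w y - w x\<close>, and the weights vanish beyond the distance in the last
  hypothesis.\<close>

lemma mollify_error:
  fixes w :: "real^'d \<Rightarrow> 'b::euclidean_space"
  assumes "e > 0" and x: "cball x (real CARD('d) * e) \<subseteq> cbox a b" and w: "continuous_on (cbox a b) w"
    and d: "\<And>y. y \<in> cbox a b \<Longrightarrow> dist x y \<le> real CARD('d) * e \<Longrightarrow> norm (w y - w x) \<le> d"
  shows "norm (mollify e a b w x - w x) \<le> d"
proof -
  let ?m = "bump_mass TYPE('d) e"
  have m: "?m > 0" by (rule bump_mass_pos) fact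
  have 1: "((\<lambda>y. bump e (x - y) *\<^sub>R w y) has_integral ?m *\<^sub>R mollify e a b w x) (cbox a b)"
    using m unfolding mollify_def
    by (simp, intro integrable_integral integrable_continuous continuous_intros
        continuous_on_bump_diff w)
  have b: "((\<lambda>y. bump e (x - y)) has_integral ?m) (cbox a b)"
    by (rule has_integral_bump_diff[OF x])
  have 2: "((\<lambda>y. bump e (x - y) *\<^sub>R w x) has_integral ?m *\<^sub>R w x) (cbox a b)"
    by (rule has_integral_scaleR_left[OF b])
  have 3: "((\<lambda>y. bump e (x - y) *\<^sub>R (w y - w x)) has_integral
      ?m *\<^sub>R (mollify e a b w x - w x)) (cbox a b)"
    using has_integral_diff[OF 1 2] by (simp add: scaleR_diff_right)
  have 4: "((\<lambda>y. bump e (x - y) * d) has_integral ?m * d) (cbox a b)"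
    by (rule has_integral_mult_left[OF b])
  have 5: "norm (bump e (x - y) *\<^sub>R (w y - w x)) \<le> bump e (x - y) * d" if "y \<in> cbox a b" for y
  proof (cases "bump e (x - y) = 0")
    case False
    then have "norm (w y - w x) \<le> d"
      by (intro d that bump_diff_nonzero_imp_dist)
    then show ?thesis
      by (simp add: bump_nonneg mult_left_mono)
  qed simp
  have "norm (?m *\<^sub>R (mollify e a b w x - w x)) \<le> ?m * d"
    using integral_norm_bound_integral[OF has_integral_integrable[OF 3] has_integral_integrable[OF 4] 5]
    unfolding integral_unique[OF 3] integral_unique[OF 4] .
  then show ?thesis
    using m by simp
qed

text \<open>Uniform continuity on the compact box gives a \<delta> independent of \<open>x\<close>;
  this uniformity is what the gradients need in the limit argument.\<close>

lemma mollify_uniform_limit: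
  fixes w :: "real^'d \<Rightarrow> 'b::euclidean_space"
  assumes w: "continuous_on (cbox a b) w" and "d > 0"
  obtains \<delta> where "\<delta> > 0"
    "\<And>e x. 0 < e \<Longrightarrow> real CARD('d) * e < \<delta> \<Longrightarrow> cball x (real CARD('d) * e) \<subseteq> cbox a b \<Longrightarrow>
      norm (mollify e a b w x - w x) \<le> d"
proof -
  obtain \<delta> where \<delta>: "\<delta> > 0"
    "\<And>x y. x \<in> cbox a b \<Longrightarrow> y \<in> cbox a b \<Longrightarrow> dist y x < \<delta> \<Longrightarrow> dist (w y) (w x) < d"
    using compact_uniformly_continuous[OF w compact_cbox] \<open>d > 0\<close>
    unfolding uniformly_continuous_on_def by metis
  show thesis
  proof (rule that[OF \<delta>(1)])
    fix e x assume e: "0 < e" "real CARD('d) * e < \<delta>" and sub: "cball x (real CARD('d) * e) \<subseteq> cbox a b"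
    have "x \<in> cball x (real CARD('d) * e)" using e by simp
    then have x: "x \<in> cbox a b" using sub by blast
    show "norm (mollify e a b w x - w x) \<le> d"
    proof (rule mollify_error[OF e(1) sub w])
      fix y assume y: "y \<in> cbox a b" "dist x y \<le> real CARD('d) * e"
      then have "dist (w y) (w x) < d"
        using e by (intro \<delta>(2) x) (auto simp: dist_commute)
      then show "norm (w y - w x) \<le> d"
        by (simp add: dist_norm)
    qed
  qed
qed

section \<open>Gradients of mollifications\<close>

lemma weak_gradientD:
  assumes "weak_gradient \<Omega> v \<theta>" "test_function \<Omega> \<phi>" "\<And>x. GDERIV \<phi> x :> g x"
  shows "(LINT x:\<Omega>|lebesgue. v x * g x $ i) = - (LINT x:\<Omega>|lebesgue. \<theta> x $ i * \<phi> x)"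
  using assms unfolding weak_gradient_def by blast

text \<open>Differentiation under the integral falls on the bump, and the weak gradient identity,
  tested with the reflected bump, moves it from there to \<open>v\<close>.\<close>

lemma mollify_has_derivative:
  fixes \<Omega> :: "(real^'d) set"
  assumes op: "open \<Omega>" and ab: "cbox a b \<subseteq> \<Omega>"
    and v: "continuous_on \<Omega> v" and \<theta>: "continuous_on \<Omega> \<theta>" and wg: "weak_gradient \<Omega> v \<theta>"
    and U: "convex U" "x \<in> U" and sub: "cball x (real CARD('d) * e) \<subseteq> cbox a b"
  shows "(mollify e a b v has_derivative (\<lambda>h. h \<bullet> mollify e a b \<theta> x)) (at x within U)"
proof -
  obtain g where g: "\<And>x :: real^'d. GDERIV (bump e) x :> g x" and gi: "\<And>i. smooth_alg (\<lambda>x. g x $ i)"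
    using smooth_alg_GDERIV[OF smooth_alg_bump] by metis
  have contg: "continuous_on UNIV g"
    using continuous_on_vec_lambda[of UNIV "\<lambda>i x. g x $ i"] smooth_alg_continuous[OF gi] by simp
  have contg': "continuous_on S (\<lambda>z. g (h z))" if "continuous_on S h"
    for S and h :: "'c::topological_space \<Rightarrow> real^'d"
    using continuous_on_compose2[OF contg that] by simp
  have v': "continuous_on (cbox a b) v" and \<theta>': "continuous_on (cbox a b) \<theta>"
    using v \<theta> ab continuous_on_subset by blast+
  note [continuous_intros] = contg' v v' \<theta> \<theta>' continuous_on_bump_diff
  have I: "(\<lambda>y. v y *\<^sub>R g (x - y)) integrable_on cbox a b"
    by (intro integrable_continuous continuous_intros)
  \<comment> \<open>\<open>leibniz_rule\<close> wants the derivative as a continuous family of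
    bounded linear maps; this one is the inner product with
    \<open>v y *\<^sub>R g (x - y)\<close>.\<close>
  let ?L = "\<lambda>x y. blinfun_inner_left (v y *\<^sub>R g (x - y))"
  have "((\<lambda>x. integral (cbox a b) (\<lambda>y. bump e (x - y) *\<^sub>R v y)) has_derivative
      integral (cbox a b) (?L x)) (at x within U)"
  proof (rule leibniz_rule[OF _ _ _ \<open>x \<in> U\<close> \<open>convex U\<close>])
    fix z y
    have "((\<lambda>z. bump e (z - y)) has_derivative (\<lambda>h. h \<bullet> g (z - y))) (at z within U)"
      by (rule has_derivative_compose[OF _ g[unfolded gderiv_def]])
        (auto intro!: derivative_eq_intros)
    then show "((\<lambda>z. bump e (z - y) *\<^sub>R v y) has_derivative blinfun_apply (?L z y)) (at z within U)"
      by (auto intro!: derivative_eq_intros simp: fun_eq_iff)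
    show "(\<lambda>y. bump e (z - y) *\<^sub>R v y) integrable_on cbox a b"
      by (intro integrable_continuous continuous_intros)
  next
    show "continuous_on (U \<times> cbox a b) (\<lambda>(x, y). ?L x y)"
      unfolding case_prod_beta
      by (intro bounded_linear.continuous_on[OF bounded_linear_blinfun_inner_left]
          continuous_intros continuous_on_compose2[OF v' continuous_on_snd]) auto
  qed
  also have "integral (cbox a b) (?L x) =
      blinfun_inner_left (integral (cbox a b) (\<lambda>y. v y *\<^sub>R g (x - y)))"
    using integral_linear[OF I bounded_linear_blinfun_inner_left] by (simp add: o_def)
  \<comment> \<open>Here the weak gradient enters. As a function of \<open>y\<close> the bump has
    gradient \<open>- g (x - y)\<close>, and this sign cancels the one in
    \<open>weak_gradient\<close>.\<close>
  also have "integral (cbox a b) (\<lambda>y. v y *\<^sub>R g (x - y)) =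
      integral (cbox a b) (\<lambda>y. bump e (x - y) *\<^sub>R \<theta> y)" (is "?I = ?J")
  proof (rule vec_eq_iff[THEN iffD2], rule allI)
    fix i
    let ?\<phi> = "\<lambda>y. bump e (x - y)" and ?S = "cball x (real CARD('d) * e)"
    have supp: "{y. ?\<phi> y \<noteq> 0} \<subseteq> ?S"
      using bump_diff_nonzero_imp_dist by auto
    then have supp': "closure {y. ?\<phi> y \<noteq> 0} \<subseteq> ?S"
      by (simp add: closure_minimal)
    have "test_function \<Omega> ?\<phi>"
      unfolding test_function_def
    proof (intro conjI allI smooth_alg_C_k smooth_alg_reflect smooth_alg_bump)
      show "compact (closure {y. ?\<phi> y \<noteq> 0})"
        using supp bounded_cball bounded_subset compact_closure by blast
      show "closure {y. ?\<phi> y \<noteq> 0} \<subseteq> \<Omega>"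
        using supp' sub ab by blast
    qed
    moreover have g': "GDERIV ?\<phi> y :> - g (x - y)" for y
    proof -
      have "(?\<phi> has_derivative (\<lambda>h. (- h) \<bullet> g (x - y))) (at y)"
        by (rule has_derivative_compose[OF _ g[unfolded gderiv_def]])
          (auto intro!: derivative_eq_intros)
      then show ?thesis
        by (simp add: gderiv_def)
    qed
    ultimately have weak: "(LINT y:\<Omega>|lebesgue. v y * (- g (x - y)) $ i) =
        - (LINT y:\<Omega>|lebesgue. \<theta> y $ i * ?\<phi> y)"
      by (rule weak_gradientD[OF wg])
    have phi0: "?\<phi> y = 0" if "y \<notin> ?S" for y
      using that bump_diff_nonzero_imp_dist[of e x y] by auto
    \<comment> \<open>The reflected bump vanishes identically on the open complement of the ball, so
      its gradient does too.\<close>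
    have g0: "g (x - y) = 0" if y: "y \<notin> ?S" for y
    proof -
      have "(?\<phi> has_derivative (\<lambda>h. 0)) (at y)"
      proof (rule has_derivative_transform_within_open[OF has_derivative_const])
        show "open (- ?S)" "y \<in> - ?S"
          using y by (simp_all add: open_Compl)
        show "0 = ?\<phi> z" if "z \<in> - ?S" for z
          using that phi0[of z] by simp
      qed
      then have "GDERIV ?\<phi> y :> 0"
        by (simp add: gderiv_def)
      then show ?thesis
        using GDERIV_unique[OF g', of y 0] by simp
    qed
    have "?S \<subseteq> \<Omega>" using sub ab by blast
    note ci = compact_support_integral(3)[OF op _ compact_cball this _ sub]
    have c1: "continuous_on \<Omega> (\<lambda>y. v y * (- g (x - y)) $ i)"
      by (intro continuous_intros)
    have c2: "continuous_on \<Omega> (\<lambda>y. \<theta> y $ i * ?\<phi> y)"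
      by (intro continuous_intros)
    have "(LINT y:\<Omega>|lebesgue. v y * (- g (x - y)) $ i) =
        integral (cbox a b) (\<lambda>y. if y \<in> \<Omega> then v y * (- g (x - y)) $ i else 0)"
      by (rule ci[OF c1]) (use g0 in simp)
    also have "\<dots> = integral (cbox a b) (\<lambda>y. - (v y *\<^sub>R g (x - y)) $ i)"
      by (rule integral_cong) (use ab in auto)
    also have "\<dots> = - ?I $ i"
      using integral_component_eq_cart[OF I, of i] by simp
    finally have 1: "(LINT y:\<Omega>|lebesgue. v y * (- g (x - y)) $ i) = - ?I $ i" .
    have J: "(\<lambda>y. ?\<phi> y *\<^sub>R \<theta> y) integrable_on cbox a b"
      by (intro integrable_continuous continuous_intros)
    have "(LINT y:\<Omega>|lebesgue. \<theta> y $ i * ?\<phi> y) =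
        integral (cbox a b) (\<lambda>y. if y \<in> \<Omega> then \<theta> y $ i * ?\<phi> y else 0)"
      by (rule ci[OF c2]) (use phi0 in simp)
    also have "\<dots> = integral (cbox a b) (\<lambda>y. (?\<phi> y *\<^sub>R \<theta> y) $ i)"
      by (rule integral_cong) (use ab in \<open>auto simp: mult.commute\<close>)
    also have "\<dots> = ?J $ i"
      by (rule integral_component_eq_cart[OF J])
    finally show "?I $ i = ?J $ i"
      using weak 1 by simp
  qed
  finally have "((\<lambda>x. integral (cbox a b) (\<lambda>y. bump e (x - y) *\<^sub>R v y) /\<^sub>R bump_mass TYPE('d) e)
      has_derivative (\<lambda>h. (h \<bullet> ?J) /\<^sub>R bump_mass TYPE('d) e)) (at x within U)"
    by (intro has_derivative_scaleR_right) simp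
  then show ?thesis
    by (simp add: mollify_def[abs_def])
qed

section \<open>Passage to the limit\<close>

text \<open>On a small ball the mollifications of \<open>v\<close> converge pointwise to
  \<open>v\<close> and their gradients uniformly to \<theta>, so limit and derivative may be
  interchanged.\<close>

lemma continuous_weak_gradient_imp_GDERIV:
  fixes \<Omega> :: "(real^'d) set"
  assumes op: "open \<Omega>" and v: "continuous_on \<Omega> v" and \<theta>: "continuous_on \<Omega> \<theta>"
    and wg: "weak_gradient \<Omega> v \<theta>" and x0: "x0 \<in> \<Omega>"
  shows "GDERIV v x0 :> \<theta> x0"
proof -
  obtain a b where ab: "x0 \<in> box a b" "cbox a b \<subseteq> \<Omega>"
    using open_contains_cbox[OF op x0] by metis
  obtain \<rho>' where \<rho>': "\<rho>' > 0" "ball x0 \<rho>' \<subseteq> box a b"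
    using ab(1) open_box open_contains_ball by blast
  \<comment> \<open>One half of the radius is for the points of \<open>?U\<close>, the other half
    for the reach of the bump about them.\<close>
  define \<rho> where "\<rho> = \<rho>' / 2"
  have \<rho>: "\<rho> > 0" using \<rho>' by (simp add: \<rho>_def)
  let ?U = "ball x0 \<rho>"
  \<comment> \<open>Chosen so that the reach \<open>real CARD('d) * \<epsilon> n\<close> equals
    \<rho> / (n + 1), which is at most \<rho> and tends to 0.\<close>
  define \<epsilon> where "\<epsilon> n = \<rho> / (real CARD('d) * (real n + 1))" for n
  have \<epsilon>: "\<epsilon> n > 0" "real CARD('d) * \<epsilon> n = \<rho> / (real n + 1)" for n
    using \<rho> by (auto simp: \<epsilon>_def)
  have sub: "cball x (real CARD('d) * \<epsilon> n) \<subseteq> cbox a b" if "x \<in> ?U" for x n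
  proof
    fix y assume "y \<in> cball x (real CARD('d) * \<epsilon> n)"
    moreover have "\<rho> / (real n + 1) \<le> \<rho>"
      using \<rho> by (simp add: field_simps)
    ultimately have "dist x y \<le> \<rho>"
      by (simp add: \<epsilon>)
    then have "dist x0 y < \<rho>'"
      using that dist_triangle[of x0 y x] by (simp add: \<rho>_def)
    then show "y \<in> cbox a b"
      using \<rho>' box_subset_cbox by (meson mem_ball subsetD)
  qed
  have v': "continuous_on (cbox a b) v" and \<theta>': "continuous_on (cbox a b) \<theta>"
    using v \<theta> ab continuous_on_subset by blast+
  have ev: "\<forall>\<^sub>F n in sequentially. real CARD('d) * \<epsilon> n < \<delta>" if "\<delta> > 0" for \<delta>
  proof -
    have "(\<lambda>n. \<rho> * inverse (real (Suc n))) \<longlonglongrightarrow> \<rho> * 0"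
      by (intro tendsto_intros LIMSEQ_inverse_real_of_nat)
    then have "(\<lambda>n. \<rho> / (real n + 1)) \<longlonglongrightarrow> 0"
      by (simp add: divide_inverse add.commute)
    then show ?thesis
      using that by (simp add: \<epsilon> order_tendstoD)
  qed
  have lim: "(\<lambda>n. mollify (\<epsilon> n) a b v x) \<longlonglongrightarrow> v x" if x: "x \<in> ?U" for x
  proof (rule tendstoI)
    fix d :: real assume "d > 0"
    then obtain \<delta> where \<delta>: "\<delta> > 0" "\<And>n. real CARD('d) * \<epsilon> n < \<delta> \<Longrightarrow>
        norm (mollify (\<epsilon> n) a b v x - v x) \<le> d / 2"
      using mollify_uniform_limit[OF v', of "d / 2"] sub[OF x] \<epsilon>(1) half_gt_zero by metis
    show "\<forall>\<^sub>F n in sequentially. dist (mollify (\<epsilon> n) a b v x) (v x) < d"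
      using ev[OF \<delta>(1)]
      by eventually_elim (use \<delta>(2) \<open>d > 0\<close> in \<open>fastforce simp: dist_norm\<close>)
  qed
  \<comment> \<open>\<open>has_derivative_sequence\<close> takes convergence at the one point
    \<open>x0\<close> and returns some limit function \<open>g\<close>, still to be identified with
    \<open>v\<close>.\<close>
  have "\<exists>g. \<forall>x\<in>?U. (\<lambda>n. mollify (\<epsilon> n) a b v x) \<longlonglongrightarrow> g x \<and>
      (g has_derivative (\<lambda>h. h \<bullet> \<theta> x)) (at x within ?U)"
  proof (rule has_derivative_sequence)
    show "(mollify (\<epsilon> n) a b v has_derivative (\<lambda>h. h \<bullet> mollify (\<epsilon> n) a b \<theta> x)) (at x within ?U)"
      if "x \<in> ?U" for n x
      by (rule mollify_has_derivative[OF op ab(2) v \<theta> wg convex_ball that sub[OF that]])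
    fix d :: real assume "d > 0"
    then obtain \<delta> where \<delta>: "\<delta> > 0" "\<And>n x. real CARD('d) * \<epsilon> n < \<delta> \<Longrightarrow> x \<in> ?U \<Longrightarrow>
        norm (mollify (\<epsilon> n) a b \<theta> x - \<theta> x) \<le> d"
      using mollify_uniform_limit[OF \<theta>'] sub \<epsilon>(1) by metis
    show "\<forall>\<^sub>F n in sequentially. \<forall>x\<in>?U. \<forall>h.
        norm (h \<bullet> mollify (\<epsilon> n) a b \<theta> x - h \<bullet> \<theta> x) \<le> d * norm h"
      using ev[OF \<delta>(1)]
    proof eventually_elim
      case (elim n)
      show ?case
      proof (intro ballI allI)
        fix x h assume x: "x \<in> ?U"
        have "norm (h \<bullet> (mollify (\<epsilon> n) a b \<theta> x - \<theta> x)) \<le> norm h * norm (mollify (\<epsilon> n) a b \<theta> x - \<theta> x)"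
          by (simp add: Cauchy_Schwarz_ineq2)
        also have "\<dots> \<le> norm h * d"
          by (intro mult_left_mono \<delta>(2) elim x) simp
        finally show "norm (h \<bullet> mollify (\<epsilon> n) a b \<theta> x - h \<bullet> \<theta> x) \<le> d * norm h"
          by (simp add: inner_diff_right mult.commute)
      qed
    qed
  qed (use \<rho> lim[of x0] in auto)
  then obtain g where g: "\<And>x. x \<in> ?U \<Longrightarrow> (\<lambda>n. mollify (\<epsilon> n) a b v x) \<longlonglongrightarrow> g x"
    "\<And>x. x \<in> ?U \<Longrightarrow> (g has_derivative (\<lambda>h. h \<bullet> \<theta> x)) (at x within ?U)" by blast
  have x0U: "x0 \<in> ?U" using \<rho> by simp
  have "(g has_derivative (\<lambda>h. h \<bullet> \<theta> x0)) (at x0)"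
    using g(2)[OF x0U] at_within_open[OF x0U open_ball] by simp
  \<comment> \<open>Both \<open>g\<close> and \<open>v\<close> are pointwise limits of the same
    sequence on \<open>?U\<close>, hence equal there.\<close>
  then show ?thesis
    unfolding gderiv_def
    by (rule has_derivative_transform_within_open[OF _ open_ball x0U])
      (use g(1) lim LIMSEQ_unique in blast)
qed

section \<open>Piecewise polynomials\<close>

abbreviation monomial :: "('d \<Rightarrow> nat) \<Rightarrow> real^'d \<Rightarrow> real" where
  "monomial \<alpha> x \<equiv> \<Prod>i\<in>UNIV. x $ i ^ \<alpha> i"

text \<open>A sum over an infinite index set would be 0 by convention; finiteness makes the sum in
  \<open>poly_on\<close> a genuine polynomial.\<close>

lemma finite_multi_index: "finite {\<alpha> :: 'd::finite \<Rightarrow> nat. (\<Sum>i\<in>UNIV. \<alpha> i) \<le> p}"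
proof (rule finite_subset)
  show "{\<alpha> :: 'd \<Rightarrow> nat. (\<Sum>i\<in>UNIV. \<alpha> i) \<le> p} \<subseteq> (\<Pi>\<^sub>E i\<in>UNIV. {..p})"
  proof
    fix \<alpha> :: "'d \<Rightarrow> nat" assume "\<alpha> \<in> {\<alpha>. (\<Sum>i\<in>UNIV. \<alpha> i) \<le> p}"
    then have "\<alpha> i \<le> p" for i
      using member_le_sum[of i UNIV \<alpha>] by auto
    then show "\<alpha> \<in> (\<Pi>\<^sub>E i\<in>UNIV. {..p})"
      by auto
  qed
qed (simp add: finite_PiE)

lemma poly_on_add:
  assumes "poly_on p S f" "poly_on p S g"
  shows "poly_on p S (\<lambda>x. f x + g x)"
proof -
  obtain c d where "\<forall>x\<in>S. f x = (\<Sum>\<alpha> | (\<Sum>i\<in>UNIV. \<alpha> i) \<le> p. c \<alpha> * monomial \<alpha> x)"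
    "\<forall>x\<in>S. g x = (\<Sum>\<alpha> | (\<Sum>i\<in>UNIV. \<alpha> i) \<le> p. d \<alpha> * monomial \<alpha> x)"
    using assms unfolding poly_on_def by blast
  then show ?thesis
    unfolding poly_on_def
    by (intro exI[of _ "\<lambda>\<alpha>. c \<alpha> + d \<alpha>"]) (simp add: distrib_right sum.distrib)
qed

lemma poly_on_0: "poly_on p S (\<lambda>x. 0)"
  unfolding poly_on_def by (intro exI[of _ "\<lambda>\<alpha>. 0"]) simp

lemma poly_on_sum:
  "(\<And>a. a \<in> A \<Longrightarrow> poly_on p S (f a)) \<Longrightarrow> poly_on p S (\<lambda>x. \<Sum>a\<in>A. f a x)"
  by (induction A rule: infinite_finite_induct) (simp_all add: poly_on_0 poly_on_add)

lemma poly_on_monomial: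
  assumes "(\<Sum>i\<in>UNIV. \<alpha> i) \<le> p"
  shows "poly_on p S (\<lambda>x. k * monomial \<alpha> x)"
  unfolding poly_on_def
proof (intro exI[of _ "\<lambda>\<beta>. if \<beta> = \<alpha> then k else 0"] ballI)
  fix x
  have "(\<Sum>\<beta> | (\<Sum>i\<in>UNIV. \<beta> i) \<le> p. (if \<beta> = \<alpha> then k else 0) * monomial \<beta> x) =
      (\<Sum>\<beta> | (\<Sum>i\<in>UNIV. \<beta> i) \<le> p. if \<beta> = \<alpha> then k * monomial \<alpha> x else 0)"
    by (rule sum.cong) auto
  also have "\<dots> = k * monomial \<alpha> x"
    by (subst sum.delta[OF finite_multi_index]) (use assms in simp)
  finally show "k * monomial \<alpha> x =
      (\<Sum>\<beta> | (\<Sum>i\<in>UNIV. \<beta> i) \<le> p. (if \<beta> = \<alpha> then k else 0) * monomial \<beta> x)" ..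
qed

section \<open>Gradients of polynomials on the elements\<close>

text \<open>The truncated difference is harmless: where \<open>\<alpha> i = 0\<close>, the factor
  \<open>real (\<alpha> i)\<close> vanishes.\<close>

lemma GDERIV_monomial:
  fixes x :: "real^'d"
  shows "GDERIV (monomial \<alpha>) x :> (\<chi> i. real (\<alpha> i) * monomial (\<alpha>(i := \<alpha> i - 1)) x)"
proof -
  have "((\<lambda>x::real^'d. x $ i ^ \<alpha> i) has_derivative
      (\<lambda>h. real (\<alpha> i) * h $ i * x $ i ^ (\<alpha> i - 1))) (at x)" for i
    by (rule has_derivative_eq_rhs[OF has_derivative_power[OF
          bounded_linear.has_derivative[OF bounded_linear_vec_nth has_derivative_ident]]])
      (simp add: mult_ac)
  then have "(monomial \<alpha> has_derivative
      (\<lambda>h. \<Sum>i\<in>UNIV. real (\<alpha> i) * h $ i * x $ i ^ (\<alpha> i - 1) * (\<Prod>j\<in>UNIV - {i}. x $ j ^ \<alpha> j))) (at x)"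
    by (rule has_derivative_prod)
  moreover have "monomial (\<alpha>(i := \<alpha> i - 1)) x =
      x $ i ^ (\<alpha> i - 1) * (\<Prod>j\<in>UNIV - {i}. x $ j ^ \<alpha> j)" for i
    by (subst prod.remove[of UNIV i]) (auto intro!: prod.cong)
  ultimately show ?thesis
    by (simp add: gderiv_def inner_vec_def mult_ac)
qed

text \<open>At a boundary point of \<open>K\<close> the values of \<open>v\<close> on
  \<open>K\<close> need not describe a full neighbourhood. The gradient is therefore computed in the
  interior and carried to the rest of \<open>K\<close> within \<Omega> by continuity.\<close>

lemma poly_on_gradient:
  fixes \<Omega> K :: "(real^'d) set"
  assumes op: "open \<Omega>" and K: "K \<subseteq> closure (interior K)" and p: "poly_on p (K \<inter> \<Omega>) v"
    and v: "\<And>x. x \<in> \<Omega> \<Longrightarrow> GDERIV v x :> \<theta> x" and \<theta>: "continuous_on \<Omega> \<theta>"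
  shows "poly_on (p - 1) (K \<inter> \<Omega>) (\<lambda>x. \<theta> x $ i)"
proof -
  let ?A = "{\<alpha> :: 'd \<Rightarrow> nat. (\<Sum>i\<in>UNIV. \<alpha> i) \<le> p}"
  obtain c where c: "\<And>x. x \<in> K \<inter> \<Omega> \<Longrightarrow> v x = (\<Sum>\<alpha>\<in>?A. c \<alpha> * monomial \<alpha> x)"
    using p unfolding poly_on_def by blast
  \<comment> \<open>The formal i-th partial derivative of the polynomial representing
    \<open>v\<close> on \<open>K\<close>.\<close>
  define Q where "Q x = (\<Sum>\<alpha>\<in>?A. c \<alpha> * real (\<alpha> i) * monomial (\<alpha>(i := \<alpha> i - 1)) x)" for x
  have eq: "\<theta> x $ i = Q x" if x: "x \<in> interior K \<inter> \<Omega>" for x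
  proof -
    have "((\<lambda>x. \<Sum>\<alpha>\<in>?A. c \<alpha> * monomial \<alpha> x) has_derivative (\<lambda>h. \<Sum>\<alpha>\<in>?A. c \<alpha> *
        (h \<bullet> (\<chi> i. real (\<alpha> i) * monomial (\<alpha>(i := \<alpha> i - 1)) x)))) (at x)"
      by (intro has_derivative_sum has_derivative_mult_right GDERIV_monomial[unfolded gderiv_def])
    then have "(v has_derivative (\<lambda>h. \<Sum>\<alpha>\<in>?A. c \<alpha> *
        (h \<bullet> (\<chi> i. real (\<alpha> i) * monomial (\<alpha>(i := \<alpha> i - 1)) x)))) (at x)"
      by (rule has_derivative_transform_within_open[of _ _ _ _ "interior K \<inter> \<Omega>"])
        (use x op c interior_subset[of K] in \<open>auto simp: subset_iff\<close>)
    moreover have "(v has_derivative (\<lambda>h. h \<bullet> \<theta> x)) (at x)"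
      using v x by (simp add: gderiv_def)
    ultimately have "(\<lambda>h. \<Sum>\<alpha>\<in>?A. c \<alpha> * (h \<bullet> (\<chi> i. real (\<alpha> i) *
        monomial (\<alpha>(i := \<alpha> i - 1)) x))) = (\<lambda>h. h \<bullet> \<theta> x)"
      by (rule has_derivative_unique)
    \<comment> \<open>The i-th unit vector extracts the i-th partial derivative from both
      sides.\<close>
    from fun_cong[OF this, of "axis i 1"] show ?thesis
      by (simp add: inner_axis' Q_def mult.assoc)
  qed
  have Q: "continuous_on \<Omega> Q"
    unfolding Q_def by (intro continuous_intros)
  have "\<theta> x $ i = Q x" if x: "x \<in> K \<inter> \<Omega>" for x
  proof -
    \<comment> \<open>Since \<Omega> is open, the interior points approaching \<open>x\<close> can
      be taken in \<Omega>.\<close>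
    have "x \<in> closure (interior K \<inter> \<Omega>)"
      using open_Int_closure_subset[OF op, of "interior K"] x K by (auto simp: Int_commute)
    then obtain s where s: "\<And>n. s n \<in> interior K \<inter> \<Omega>" "s \<longlonglongrightarrow> x"
      unfolding closure_sequential by blast
    have "isCont (\<lambda>x. \<theta> x $ i) x" "isCont Q x"
      using x op Q continuous_on_component[OF \<theta>, of i] continuous_on_eq_continuous_at by blast+
    then have "(\<lambda>n. \<theta> (s n) $ i) \<longlonglongrightarrow> \<theta> x $ i" "(\<lambda>n. Q (s n)) \<longlonglongrightarrow> Q x"
      using s(2) isCont_tendsto_compose by blast+
    then show ?thesis
      using eq[OF s(1)] LIMSEQ_unique by simp
  qed
  moreover have "poly_on (p - 1) (K \<inter> \<Omega>) Q"
    unfolding Q_def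
  proof (rule poly_on_sum)
    fix \<alpha> assume \<alpha>: "\<alpha> \<in> ?A"
    show "poly_on (p - 1) (K \<inter> \<Omega>) (\<lambda>x. c \<alpha> * real (\<alpha> i) * monomial (\<alpha>(i := \<alpha> i - 1)) x)"
    \<comment> \<open>If \<open>\<alpha> i = 0\<close>, the exponent is not lowered and the degree
      may still be \<open>p\<close>, but the coefficient is zero. Otherwise the total degree drops
      by exactly one.\<close>
    proof (cases "\<alpha> i = 0")
      case True
      then show ?thesis by (simp add: poly_on_0)
    next
      case False
      have "sum \<alpha> UNIV = \<alpha> i + sum \<alpha> (UNIV - {i})"
        by (rule sum.remove) auto
      moreover have "sum (\<alpha>(i := \<alpha> i - 1)) UNIV = (\<alpha> i - 1) + sum \<alpha> (UNIV - {i})"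
        by (subst sum.remove[of UNIV i]) (auto intro!: sum.cong)
      ultimately show ?thesis
        using False \<alpha> by (intro poly_on_monomial) simp
    qed
  qed
  ultimately show ?thesis
    unfolding poly_on_def by simp
qed

text \<open>In full dimension the interior of a convex set is its relative interior, which is
  nonempty, and a convex set with nonempty interior has the same closure as its interior.\<close>

lemma simplex_subset_closure_interior:
  fixes K :: "'a::euclidean_space set"
  assumes "int DIM('a) simplex K"
  shows "K \<subseteq> closure (interior K)"
proof -
  have K: "convex K" "aff_dim K = int DIM('a)"
    using assms convex_simplex aff_dim_simplex by blast+
  then have "K \<noteq> {}" by auto
  then have "interior K \<noteq> {}"
    using K interior_rel_interior[of K] rel_interior_eq_empty[of K] by simp
  then show ?thesis
    using convex_closure_interior[OF K(1)] closure_subset by blast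
qed

section \<open>Equality of the two spaces\<close>

theorem lemma4p5:
  fixes \<Omega> :: "(real^'d) set" and \<T> :: "(real^'d) set set" and \<sigma> :: real and p :: nat
  assumes "CARD('d) \<in> {2, 3}"
    and "lipschitz_polyhedral_domain \<Omega>"
    and "simplicial_partition \<T> \<Omega>"
    and "shape_regular \<sigma> \<T>"
    and "p \<ge> 1"
  shows "W_space \<Omega> \<T> p =
    {v \<in> W_tilde_space \<Omega> \<T> p. \<exists>\<theta> \<in> G_space \<Omega> \<T> p. weak_gradient \<Omega> v \<theta>}"
proof -
  have op: "open \<Omega>"
    using assms(2) by (simp add: lipschitz_polyhedral_domain_def)
  have K: "K \<subseteq> closure (interior K)" if "K \<in> \<T>" for K
    using assms(3) that simplex_subset_closure_interior unfolding simplicial_partition_def by blast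
  \<comment> \<open>\<open>C_k\<close> asks for continuity of each component of the gradient; the
    analytic lemmas use the vector field as a whole.\<close>
  have C1: "C_k 1 \<Omega> v \<longleftrightarrow> (\<exists>\<theta>. (\<forall>x\<in>\<Omega>. GDERIV v x :> \<theta> x) \<and> continuous_on \<Omega> \<theta>)" for v
    using continuous_on_vec_lambda[of \<Omega> "\<lambda>i x. \<theta> x $ i" for \<theta>]
    by (auto intro: continuous_on_component)
  show ?thesis
  proof (intro equalityI subsetI)
    \<comment> \<open>In this direction the classical gradient is the witness for the weak
      one.\<close>
    fix v assume "v \<in> W_space \<Omega> \<T> p"
    then obtain \<theta> where v: "\<And>x. x \<in> \<Omega> \<Longrightarrow> GDERIV v x :> \<theta> x" and \<theta>: "continuous_on \<Omega> \<theta>"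
      and p: "\<And>K. K \<in> \<T> \<Longrightarrow> poly_on p (K \<inter> \<Omega>) v"
      unfolding W_space_def C1 by blast
    have "v \<in> W_tilde_space \<Omega> \<T> p"
      using p GDERIV_imp_continuous_on[of \<Omega> v \<theta>] v by (simp add: W_tilde_space_def)
    moreover have "\<theta> \<in> G_space \<Omega> \<T> p"
      using \<theta> poly_on_gradient[OF op K p v \<theta>] by (simp add: G_space_def)
    ultimately show "v \<in> {v \<in> W_tilde_space \<Omega> \<T> p. \<exists>\<theta> \<in> G_space \<Omega> \<T> p. weak_gradient \<Omega> v \<theta>}"
      using gradient_imp_weak_gradient[OF op v \<theta>] by blast
  next
    fix v assume "v \<in> {v \<in> W_tilde_space \<Omega> \<T> p. \<exists>\<theta> \<in> G_space \<Omega> \<T> p. weak_gradient \<Omega> v \<theta>}"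
    then obtain \<theta> where v: "continuous_on \<Omega> v" "\<And>K. K \<in> \<T> \<Longrightarrow> poly_on p (K \<inter> \<Omega>) v"
      and \<theta>: "continuous_on \<Omega> \<theta>" and wg: "weak_gradient \<Omega> v \<theta>"
      by (auto simp: W_tilde_space_def G_space_def)
    \<comment> \<open>The continuous weak gradient is the classical gradient at every point of
      \<Omega>, so \<open>v\<close> is of class C^1.\<close>
    have "C_k 1 \<Omega> v"
      unfolding C1 using continuous_weak_gradient_imp_GDERIV[OF op v(1) \<theta> wg] \<theta> by blast
    with v show "v \<in> W_space \<Omega> \<T> p"
      by (simp add: W_space_def)
  qed
qed

end
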